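(* Let $C$ be a commutative ring with identity, let $\lambda\in C$, and let $\mathfrak{q}=\{q_n(x)\}_{n\in\mathbb{N}}$ be a fixed pseudo-basis of $C[[x]]$ of $\lambda$-binomial type. Let $\{p_n(x)\}_{n\in\mathbb{N}}$ be a basis of $C\langle\mathfrak{q}\rangle$. The following statements are equivalent. (1) The sequence $\{p_n(x)\}$ is a sequence of $\lambda$-binomial type. (2) The sequence $\{p_n(x)\}$ is the dual basis of a $\lambda$-divided power pseudo-basis of $U_\lambda C$, i.e. there is a $\lambda$-divided power pseudo-basis $\{v_n\}$ of $U_\lambda C$ with $\langle v_m\mid p_n(x)\rangle_\lambda=\delta_{m,n}$ for all $m,n$. (3) For all $u,v\in U_\lambda C$ and all $n\in\mathbb{N}$, $$\langle uv\mid p_n(x)\rangle_\lambda=\sum_{i=0}^n\sum_{j=0}^n\lambda^i\binom{n}{j}\binom{j}{i}\langle u\mid p_{n+i-j}(x)\rangle_\lambda\,\langle v\mid p_j(x)\rangle_\lambda .$$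
   Context: $\mathbb{N}$ is the set of non-negative integers; $\binom{a}{b}=0$ if $b>a\ge 0$. $U_\lambda C=\prod_{n\in\mathbb{N}}Cu_n$ is the $C$-algebra whose elements are infinite sums $\sum_n c_nu_n$, with product $u_mu_n=\sum_{k=0}^m\binom{m+n-k}{n}\binom{n}{k}\lambda^ku_{m+n-k}$ extended to infinite sums, and topology given by the filtration $\{\sum_k c_ku_k\mid c_k=0\text{ for }k<n\}$. A pseudo-basis of $U_\lambda C$ (resp. of $C[[x]]$ with its $x$-adic topology) is a sequence that is linearly independent and generates the module as a topological $C$-module, i.e. all series $\sum_nc_nv_n$ converge and every element is uniquely such a series. A pseudo-basis $\{v_n\}$ of $U_\lambda C$ is a $\lambda$-divided power pseudo-basis if $v_mv_n=\sum_{k=0}^m\binom{m+n-k}{n}\binom{n}{k}\lambda^kv_{m+n-k}$ for all $m,n\in\mathbb{N}$. A sequence $\{p_n(x)\mid n\in\mathbb{N}\}$ in $C[[x]]$ is of $\lambda$-binomial type if for all $n\in\mathbb{N}$, $p_n(x+y)=\sum_{k=0}^n\lambda^k\sum_{i=0}^n\binom{n}{i}\binom{i}{k}p_{n+k-i}(x)p_i(y)$ in $C[[x,y]]$. $C\langle\mathfrak{q}\rangle\subset C[[x]]$ is the $C$-submodule generated by the $q_n(x)$ (finite linear combinations). The pairing $\langle\ \mid\ \rangle_\lambda:U_\lambda C\otimes C\langle\mathfrak{q}\rangle\to C$ is characterized by $\langle u_n\mid q_k\rangle_\lambda=\delta_{k,n}$, that is, $\langle\sum_nc_nu_n\mid\sum_kd_kq_k\rangle_\lambda=\sum_nc_nd_n$;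 it identifies $U_\lambda C$ with the dual $C$-module of $C\langle\mathfrak{q}\rangle$. *)

theory Defs
  imports "HOL-Computational_Algebra.Formal_Power_Series"
begin

unbundle fps_syntax

section \<open>The algebra $U_\lambda C$\<close>

text \<open>
  The element $\sum_n c_n u_n$ of $U_\lambda C$ is represented by its coefficient
  function \<^term>\<open>c :: nat \<Rightarrow> 'a\<close>; all module operations are pointwise.
\<close>

definition U_unit :: "nat \<Rightarrow> nat \<Rightarrow> 'a::comm_ring_1"
  where "U_unit n = (\<lambda>j. if j = n then 1 else 0)"

definition U_unit_mult :: "'a::comm_ring_1 \<Rightarrow> nat \<Rightarrow> nat \<Rightarrow> nat \<Rightarrow> 'a"
  where "U_unit_mult l m n =
    (\<lambda>j. \<Sum>k\<le>m. of_nat ((m + n - k) choose n) * of_nat (n choose k) * l ^ k * U_unit (m + n - k) j)"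

text \<open>
  In the extension to infinite sums, the coefficient at $u_j$ only receives contributions
  from the products $u_m u_n$ with $m, n \le j$: a term with $k > n$ vanishes because of
  $\binom{n}{k} = 0$, and $k \le \min(m, n)$ gives $m + n - k \ge \max(m, n)$.
\<close>

lemma U_unit_mult_eq_0:
  assumes "j < m \<or> j < n"
  shows "U_unit_mult l m n j = 0"
  unfolding U_unit_mult_def U_unit_def
proof (intro sum.neutral ballI)
  fix k assume "k \<in> {..m}"
  then show "of_nat ((m + n - k) choose n) * of_nat (n choose k) * l ^ k *
      (if j = m + n - k then 1 else 0) = 0"
    using assms by (cases "k \<le> n") (auto simp: binomial_eq_0)
qed

definition U_mult :: "'a::comm_ring_1 \<Rightarrow> (nat \<Rightarrow> 'a) \<Rightarrow> (nat \<Rightarrow> 'a) \<Rightarrow> nat \<Rightarrow> 'a"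
  where "U_mult l f g = (\<lambda>j. \<Sum>m\<le>j. \<Sum>n\<le>j. f m * g n * U_unit_mult l m n j)"

definition U_filtration :: "nat \<Rightarrow> (nat \<Rightarrow> 'a::comm_ring_1) set"
  where "U_filtration n = {c. \<forall>k<n. c k = 0}"

text \<open>Convergence of $\sum_n w_n$ to $s$ in the topology given by the filtration.\<close>

definition U_sums :: "(nat \<Rightarrow> nat \<Rightarrow> 'a::comm_ring_1) \<Rightarrow> (nat \<Rightarrow> 'a) \<Rightarrow> bool"
  where "U_sums w s \<longleftrightarrow>
    (\<forall>N. \<forall>\<^sub>F M in sequentially. (\<lambda>j. s j - (\<Sum>n<M. w n j)) \<in> U_filtration N)"

definition U_pseudo_basis :: "(nat \<Rightarrow> nat \<Rightarrow> 'a::comm_ring_1) \<Rightarrow> bool"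
  where "U_pseudo_basis v \<longleftrightarrow>
    (\<forall>c. \<exists>s. U_sums (\<lambda>n j. c n * v n j) s) \<and>
    (\<forall>s. \<exists>!c. U_sums (\<lambda>n j. c n * v n j) s)"

definition divided_power_pseudo_basis ::
    "'a::comm_ring_1 \<Rightarrow> (nat \<Rightarrow> nat \<Rightarrow> 'a) \<Rightarrow> bool"
  where "divided_power_pseudo_basis l v \<longleftrightarrow>
    U_pseudo_basis v \<and>
    (\<forall>m n. U_mult l (v m) (v n) =
      (\<lambda>j. \<Sum>k\<le>m. of_nat ((m + n - k) choose n) * of_nat (n choose k) * l ^ k * v (m + n - k) j))"


section \<open>Power series\<close>

text \<open>
  The library metric on \<^typ>\<open>'a fps\<close> induces the $x$-adic topology, so
  \<^const>\<open>summable\<close> and \<^const>\<open>sums\<close> refer to $x$-adic convergence.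
\<close>

definition fps_scale :: "'a::comm_ring_1 \<Rightarrow> 'a fps \<Rightarrow> 'a fps"
  where "fps_scale c f = fps_const c * f"

interpretation fps_module: module fps_scale
  by unfold_locales
    (simp_all add: fps_scale_def algebra_simps flip: fps_const_add fps_const_mult)

definition fps_pseudo_basis :: "(nat \<Rightarrow> 'a::comm_ring_1 fps) \<Rightarrow> bool"
  where "fps_pseudo_basis q \<longleftrightarrow>
    (\<forall>c. summable (\<lambda>n. fps_scale (c n) (q n))) \<and>
    (\<forall>f. \<exists>!c. (\<lambda>n. fps_scale (c n) (q n)) sums f)"

text \<open>
  $C[[x,y]]$ is rendered as $C[[x]][[y]]$, i.e. \<^typ>\<open>'a fps fps\<close> with inner variable $x$ and
  outer variable $y$; the coefficient of $x^i y^j$ in \<open>F\<close> is \<open>F $ j $ i\<close>.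
\<close>

definition fps_in_x :: "'a::comm_ring_1 fps \<Rightarrow> 'a fps fps"
  where "fps_in_x f = fps_const f"

definition fps_in_y :: "'a::comm_ring_1 fps \<Rightarrow> 'a fps fps"
  where "fps_in_y f = Abs_fps (\<lambda>j. fps_const (f $ j))"

text \<open>
  $f(x+y) = \sum_n f_n (x+y)^n$. As $(x+y)^n$ is homogeneous of degree $n$, the coefficient of
  $x^i y^j$ is determined by the summands with $n \le i + j$. The library's
  \<^const>\<open>fps_compose\<close> is not applicable, since $x + y$ has the nonzero constant
  coefficient $x$ as a series in the outer variable $y$.
\<close>

definition fps_at_x_plus_y :: "'a::comm_ring_1 fps \<Rightarrow> 'a fps fps"
  where "fps_at_x_plus_y f = Abs_fps (\<lambda>j. Abs_fps (\<lambda>i.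
    \<Sum>n\<le>i + j. f $ n * ((fps_in_x fps_X + fps_in_y fps_X) ^ n $ j $ i)))"

lemma x_plus_y_power_nth:
  "(fps_in_x fps_X + fps_in_y fps_X :: 'a::comm_ring_1 fps fps) ^ n $ j $ i =
    (if n = i + j then of_nat (n choose i) else 0)"
proof -
  have y: "(fps_in_y fps_X :: 'a fps fps) = fps_X"
    by (rule fps_ext) (auto simp: fps_in_y_def)
  have "(fps_in_x fps_X + fps_in_y fps_X :: 'a fps fps) ^ n =
      (\<Sum>k\<le>n. of_nat (n choose k) * fps_const (fps_X ^ k) * fps_X ^ (n - k))"
    unfolding y fps_in_x_def by (simp add: binomial_ring fps_const_power)
  also have "\<dots> $ j $ i =
      (\<Sum>k\<le>n. if k = i then (if j = n - k then of_nat (n choose k) else 0) else 0)"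
    unfolding fps_sum_nth
  proof (intro sum.cong refl)
    fix k
    have "of_nat (n choose k) * fps_const (fps_X ^ k) * fps_X ^ (n - k) =
        (fps_const (fps_const (of_nat (n choose k)) * fps_X ^ k) * fps_X ^ (n - k) :: 'a fps fps)"
      by (simp add: fps_of_nat flip: fps_const_mult)
    then show "(of_nat (n choose k) * fps_const (fps_X ^ k) * fps_X ^ (n - k) :: 'a fps fps) $ j $ i =
        (if k = i then (if j = n - k then of_nat (n choose k) else 0) else 0)"
      by (auto simp: fps_X_power_nth)
  qed
  also have "\<dots> = (if n = i + j then of_nat (n choose i) else 0)"
    by (auto simp: sum.delta)
  finally show ?thesis .
qed

definition binomial_type :: "'a::comm_ring_1 \<Rightarrow> (nat \<Rightarrow> 'a fps) \<Rightarrow> bool"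
  where "binomial_type l p \<longleftrightarrow>
    (\<forall>n. fps_at_x_plus_y (p n) =
      (\<Sum>k\<le>n. fps_const (fps_const (l ^ k)) *
        (\<Sum>i\<le>n. of_nat (n choose i) * of_nat (i choose k) *
          fps_in_x (p (n + k - i)) * fps_in_y (p i))))"


section \<open>The submodule generated by a pseudo-basis, and the pairing\<close>

abbreviation fps_gen :: "(nat \<Rightarrow> 'a::comm_ring_1 fps) \<Rightarrow> 'a fps set"
  where "fps_gen q \<equiv> fps_module.span (range q)"

definition basis_seq :: "(nat \<Rightarrow> 'a::comm_ring_1 fps) \<Rightarrow> 'a fps set \<Rightarrow> bool"
  where "basis_seq p M \<longleftrightarrow>
    inj p \<and> fps_module.independent (range p) \<and> fps_module.span (range p) = M"

text \<open>
  \<open>U_pairing q c f\<close> is $\langle \sum_n c_n u_n \mid f\rangle_\lambda$ for $f$ in the submodule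
  generated by the pseudo-basis \<open>q\<close>; \<open>fps_module.representation (range q) f (q n)\<close> is the
  coefficient $d_n$ in $f = \sum_n d_n q_n$.
\<close>

definition U_pairing ::
    "(nat \<Rightarrow> 'a::comm_ring_1 fps) \<Rightarrow> (nat \<Rightarrow> 'a) \<Rightarrow> 'a fps \<Rightarrow> 'a"
  where "U_pairing q c f =
    (\<Sum>n | fps_module.representation (range q) f (q n) \<noteq> 0.
      c n * fps_module.representation (range q) f (q n))"

lemma fps_pseudo_basis_imp_basis_seq:
  assumes "fps_pseudo_basis q"
  shows "basis_seq q (fps_gen q)"
proof -
  have uniq: "c = d" if "(\<lambda>n. fps_scale (c n) (q n)) sums f" "(\<lambda>n. fps_scale (d n) (q n)) sums f"
    for c d f
    using assms that unfolding fps_pseudo_basis_def by blast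
  have fin: "(\<lambda>n. fps_scale (if n \<in> S then c n else 0) (q n)) sums (\<Sum>n\<in>S. fps_scale (c n) (q n))"
    if "finite S" for S c
  proof -
    have "(\<lambda>n. fps_scale (if n \<in> S then c n else 0) (q n)) sums
        (\<Sum>n\<in>S. fps_scale (if n \<in> S then c n else 0) (q n))"
      by (rule sums_finite) (use that in auto)
    then show ?thesis by (simp cong: sum.cong)
  qed
  have inj: "inj q"
  proof (rule injI, rule ccontr)
    fix m n assume eq: "q m = q n" and ne: "m \<noteq> n"
    have "(\<lambda>i. if i \<in> {m} then 1 else 0 :: 'a) = (\<lambda>i. if i \<in> {n} then 1 else 0)"
      by (rule uniq[where f = "q m"]) (use fin[of "{m}" "\<lambda>_. 1"] fin[of "{n}" "\<lambda>_. 1"] eq in simp_all)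
    from fun_cong[OF this, of m] ne show False by simp
  qed
  have "fps_module.independent (range q)"
    unfolding fps_module.dependent_explicit
  proof clarify
    fix t u v assume t: "finite t" "t \<subseteq> range q" and s: "(\<Sum>v\<in>t. fps_scale (u v) v) = 0"
      and v: "v \<in> t" "u v \<noteq> 0"
    define S where "S = q -` t"
    have S: "finite S" "t = q ` S" using t inj unfolding S_def by (auto intro: finite_vimageI)
    have "(\<Sum>n\<in>S. fps_scale (u (q n)) (q n)) = 0"
      using s unfolding S(2) by (subst (asm) sum.reindex) (use inj in \<open>auto intro: inj_on_subset\<close>)
    then have "(\<lambda>n. fps_scale (if n \<in> S then u (q n) else 0) (q n)) sums 0"
      using fin[OF S(1), of "\<lambda>n. u (q n)"] by simp
    moreover have "(\<lambda>n. fps_scale 0 (q n)) sums 0" by simp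
    ultimately have "(\<lambda>n. if n \<in> S then u (q n) else 0) = (\<lambda>_. 0)"
      by (rule uniq[where f = 0 and d = "\<lambda>_. 0"])
    then have "u (q n) = 0" if "n \<in> S" for n using that by (metis (mono_tags))
    then show False using v S(2) by auto
  qed
  with inj show ?thesis by (simp add: basis_seq_def)
qed

lemma U_pairing_sum:
  assumes "fps_pseudo_basis q" "finite {n. d n \<noteq> 0}"
  shows "U_pairing q c (\<Sum>n | d n \<noteq> 0. fps_scale (d n) (q n)) = (\<Sum>n | d n \<noteq> 0. c n * d n)"
proof -
  let ?S = "{n. d n \<noteq> 0}" and ?f = "\<Sum>n | d n \<noteq> 0. fps_scale (d n) (q n)"
  have inj: "inj q" and ind: "fps_module.independent (range q)"
    using fps_pseudo_basis_imp_basis_seq[OF assms(1)] by (auto simp: basis_seq_def)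
  define g where "g = (\<lambda>b. if b \<in> range q then d (inv q b) else 0)"
  have gq: "g (q n) = d n" for n by (simp add: g_def inj)
  have supp: "{b. g b \<noteq> 0} = q ` ?S" using inj by (auto simp: g_def inj_eq split: if_splits)
  have "fps_module.representation (range q) ?f = g"
  proof (rule fps_module.representation_eqI[OF ind])
    show "?f \<in> fps_gen q"
      by (intro fps_module.span_sum fps_module.span_scale fps_module.span_base) auto
    show "\<And>b. g b \<noteq> 0 \<Longrightarrow> b \<in> range q" by (auto simp: g_def split: if_splits)
    show "finite {b. g b \<noteq> 0}" unfolding supp using assms(2) by simp
    show "(\<Sum>b | g b \<noteq> 0. fps_scale (g b) b) = ?f"
      unfolding supp by (subst sum.reindex) (use inj gq in \<open>auto intro: inj_on_subset\<close>)
  qed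
  then show ?thesis by (simp add: U_pairing_def gq)
qed

end

theory Submission
  imports Defs
begin

text \<open>
  The coefficient functionals $f \mapsto [x^i] f$ on $C\langle\mathfrak{q}\rangle$ are elements
  $\varepsilon_i$ of $U_\lambda C$, and since $\mathfrak{q}$ is of $\lambda$-binomial type, the
  product $\varepsilon_i \varepsilon_j$ is the functional $f \mapsto [x^i y^j] f(x + y)$. Hence (1)
  is the identity (3) restricted to $u, v$ among the $\varepsilon_i$, and (2) is (3) restricted to
  $u, v$ among the members of the dual basis of $\{p_n\}$. Both families separate the points of
  $C\langle\mathfrak{q}\rangle$. For fixed $v$ and $n$, the two sides of (3) as functions of $u$
  are pairings with fixed elements of $C\langle\mathfrak{q}\rangle$, and similarly in $v$;
  therefore (3) extends from a separating family to all of $U_\lambda C$.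
\<close>

section \<open>Structure constants\<close>

text \<open>The left side is the shape used in binomial type and in statement (3). For fixed
  \<open>j\<close> the substitution \<open>m = N + i - j\<close> turns it into coefficients of
  \<open>u_N\<close> in the products \<open>u_m u_j\<close>.\<close>

lemma sum_U_unit_mult:
  fixes l :: "'a::comm_ring_1"
  shows "(\<Sum>i\<le>N. \<Sum>j\<le>N. l ^ i * of_nat (N choose j) * of_nat (j choose i) * G (N + i - j) j) =
    (\<Sum>m\<le>N. \<Sum>n\<le>N. U_unit_mult l m n N * G m n)"
proof -
  have "(\<Sum>i\<le>N. l ^ i * of_nat (N choose j) * of_nat (j choose i) * G (N + i - j) j) =
      (\<Sum>m\<le>N. U_unit_mult l m j N * G m j)" if "j \<le> N" for j
  proof -
    let ?c = "\<lambda>k. of_nat (N choose j) * of_nat (j choose k) * l ^ k"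
    have "(\<Sum>m\<le>N. U_unit_mult l m j N * G m j) =
        (\<Sum>m\<le>N. \<Sum>k\<le>N. if N + k = m + j then ?c k * G m j else 0)"
    proof (intro sum.cong refl)
      fix m assume m: "m \<in> {..N}"
      have "U_unit_mult l m j N * G m j =
          (\<Sum>k\<le>m. if N + k = m + j then ?c k * G m j else 0)"
        unfolding U_unit_mult_def U_unit_def sum_distrib_right
      proof (intro sum.cong refl)
        fix k assume "k \<in> {..m}"
        \<comment> \<open>The additive form is free of truncated subtraction and can later be solved
          for \<open>m\<close>.\<close>
        then have "N = m + j - k \<longleftrightarrow> N + k = m + j" by auto
        then show "of_nat (m + j - k choose j) * of_nat (j choose k) * l ^ k *
            (if N = m + j - k then 1 else 0) * G m j =
            (if N + k = m + j then ?c k * G m j else 0)"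
          by auto
      qed
      also have "\<dots> = (\<Sum>k\<le>N. if N + k = m + j then ?c k * G m j else 0)"
        \<comment> \<open>For \<open>k > m\<close> the condition \<open>N + k = m + j\<close> fails
          because \<open>j \<le> N\<close>.\<close>
        by (rule sum.mono_neutral_left) (use m that in auto)
      finally show "U_unit_mult l m j N * G m j =
          (\<Sum>k\<le>N. if N + k = m + j then ?c k * G m j else 0)" .
    qed
    also have "\<dots> = (\<Sum>k\<le>N. \<Sum>m\<le>N. if N + k = m + j then ?c k * G m j else 0)"
      by (rule sum.swap)
    also have "\<dots> = (\<Sum>k\<le>N. l ^ k * of_nat (N choose j) * of_nat (j choose k) * G (N + k - j) j)"
    proof (intro sum.cong refl)
      fix k
      show "(\<Sum>m\<le>N. if N + k = m + j then ?c k * G m j else 0) =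
          l ^ k * of_nat (N choose j) * of_nat (j choose k) * G (N + k - j) j"
      \<comment> \<open>If \<open>k \<le> j\<close>, the index \<open>N + k - j\<close> is at most
        \<open>N\<close>; otherwise \<open>j choose k\<close> vanishes.\<close>
      proof (cases "k \<le> j")
        case True
        have "(\<Sum>m\<le>N. if N + k = m + j then ?c k * G m j else 0) =
            (\<Sum>m\<le>N. if m = N + k - j then ?c k * G m j else 0)"
          by (intro sum.cong refl) (use that in auto)
        then show ?thesis using True that by (simp add: mult_ac)
      next
        case False
        then show ?thesis by (simp add: binomial_eq_0 cong: if_cong)
      qed
    qed
    finally show ?thesis by simp
  qed
  then show ?thesis
    by (subst sum.swap, subst (2) sum.swap) simp
qed

text \<open>This evaluates the right side of the product formula on two dual vectors. If
  \<open>m > N\<close> or \<open>n > N\<close>, no summand survives, and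
  \<open>U_unit_mult_eq_0\<close> makes the other side vanish too.\<close>

lemma sum_U_unit_mult_delta:
  "(\<Sum>a\<le>N. \<Sum>b\<le>N. U_unit_mult l a b N *
      ((if m = a then 1 else 0) * (if n = b then 1 else 0))) = U_unit_mult l m n N"
proof -
  have "(\<Sum>a\<le>N. \<Sum>b\<le>N. U_unit_mult l a b N *
      ((if m = a then 1 else 0) * (if n = b then 1 else 0))) =
      (\<Sum>a\<le>N. \<Sum>b\<le>N. if n = b then if m = a then U_unit_mult l m n N else 0 else 0)"
    by (intro sum.cong refl) simp
  also have "\<dots> = U_unit_mult l m n N"
    using U_unit_mult_eq_0[of N m n l] by (cases "n \<le> N") auto
  finally show ?thesis .
qed

section \<open>Binomial type read off from coefficients\<close>

lemma fps_at_x_plus_y_nth: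
  "fps_at_x_plus_y f $ j $ i = f $ (i + j) * of_nat ((i + j) choose i)"
  unfolding fps_at_x_plus_y_def by (simp add: x_plus_y_power_nth if_distrib cong: if_cong)

text \<open>Comparing coefficients of \<open>x^i y^j\<close> turns the definition into an identity
  in the structure constants. It has the shape of the product formula, with coefficient extraction
  in place of the pairing.\<close>

lemma binomial_type_nth:
  "binomial_type l p \<longleftrightarrow>
    (\<forall>N i j. fps_at_x_plus_y (p N) $ j $ i =
      (\<Sum>m\<le>N. \<Sum>n\<le>N. U_unit_mult l m n N * (p m $ i * p n $ j)))"
proof -
  have "(\<Sum>k\<le>N. fps_const (fps_const (l ^ k)) * (\<Sum>n\<le>N. of_nat (N choose n) * of_nat (n choose k) *
      fps_in_x (p (N + k - n)) * fps_in_y (p n))) $ j $ i =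
      (\<Sum>m\<le>N. \<Sum>n\<le>N. U_unit_mult l m n N * (p m $ i * p n $ j))" for N i j
  proof -
    have "(of_nat (N choose n) * of_nat (n choose k) *
        fps_in_x (p (N + k - n)) * fps_in_y (p n)) $ j $ i =
        of_nat (N choose n) * of_nat (n choose k) * (p (N + k - n) $ i * p n $ j)" for n k
    proof -
      \<comment> \<open>All factors except the series in \<open>y\<close> are constant in the outer
        variable, so they merge into one \<open>fps_const\<close>.\<close>
      have "of_nat (N choose n) * of_nat (n choose k) * fps_in_x (p (N + k - n)) * fps_in_y (p n) =
          fps_const (fps_const (of_nat (N choose n) * of_nat (n choose k)) * p (N + k - n)) *
          fps_in_y (p n)"
        by (simp add: fps_in_x_def fps_of_nat flip: fps_const_mult)
      then show ?thesis by (simp add: fps_in_y_def mult_ac)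
    qed
    then show ?thesis
      unfolding sum_U_unit_mult[where G = "\<lambda>m n. p m $ i * p n $ j", symmetric]
      by (simp add: fps_sum_nth) (simp add: sum_distrib_left mult.assoc)
  qed
  then show ?thesis
    unfolding binomial_type_def fps_eq_iff by (simp only:) blast
qed


section \<open>The pairing of a basis\<close>

text \<open>Injectivity of \<open>q\<close> transports facts about \<open>representation\<close>,
  which is indexed by vectors, to the index \<open>n\<close>.\<close>

lemma basis_seq_representation:
  assumes "basis_seq q M" "f \<in> M"
  shows "finite {n. fps_module.representation (range q) f (q n) \<noteq> 0}"
    and "(\<Sum>n | fps_module.representation (range q) f (q n) \<noteq> 0.
      fps_scale (fps_module.representation (range q) f (q n)) (q n)) = f"
proof -
  let ?r = "fps_module.representation (range q) f"
  have q: "inj q" "fps_module.independent (range q)" "f \<in> fps_gen q"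
    using assms by (auto simp: basis_seq_def)
  have im: "{b. ?r b \<noteq> 0} = q ` {n. ?r (q n) \<noteq> 0}"
    using fps_module.representation_ne_zero by fastforce
  have "finite (q ` {n. ?r (q n) \<noteq> 0})"
    using fps_module.finite_representation[of "range q" f] unfolding im .
  then show "finite {n. ?r (q n) \<noteq> 0}"
    by (rule finite_imageD) (use q(1) in \<open>auto intro: inj_on_subset\<close>)
  have "(\<Sum>b | ?r b \<noteq> 0. fps_scale (?r b) b) = f"
    using fps_module.sum_nonzero_representation_eq[OF q(2,3)] .
  then show "(\<Sum>n | ?r (q n) \<noteq> 0. fps_scale (?r (q n)) (q n)) = f"
    unfolding im by (subst (asm) sum.reindex) (use q(1) in \<open>auto intro: inj_on_subset\<close>)
qed

lemma U_pairing_superset: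
  assumes "finite S" "\<And>n. fps_module.representation (range q) f (q n) \<noteq> 0 \<Longrightarrow> n \<in> S"
  shows "U_pairing q c f = (\<Sum>n\<in>S. c n * fps_module.representation (range q) f (q n))"
  unfolding U_pairing_def by (rule sum.mono_neutral_left) (use assms in auto)

lemma U_pairing_add:
  assumes "basis_seq q M" "f \<in> M" "g \<in> M"
  shows "U_pairing q c (f + g) = U_pairing q c f + U_pairing q c g"
proof -
  let ?r = "fps_module.representation (range q)"
  let ?S = "{n. ?r f (q n) \<noteq> 0} \<union> {n. ?r g (q n) \<noteq> 0}"
  have fin: "finite ?S"
    using basis_seq_representation(1)[OF assms(1,2)] basis_seq_representation(1)[OF assms(1,3)]
    by simp
  have r: "?r (f + g) = (\<lambda>b. ?r f b + ?r g b)"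
    by (rule fps_module.representation_add) (use assms in \<open>auto simp: basis_seq_def\<close>)
  have "U_pairing q c h = (\<Sum>n\<in>?S. c n * ?r h (q n))" if "h \<in> {f + g, f, g}" for h
    by (rule U_pairing_superset[OF fin]) (use that r in auto)
  then show ?thesis by (simp add: r distrib_left sum.distrib)
qed

lemma U_pairing_scale:
  assumes "basis_seq q M" "f \<in> M"
  shows "U_pairing q c (fps_scale a f) = a * U_pairing q c f"
proof -
  let ?r = "fps_module.representation (range q)"
  have r: "?r (fps_scale a f) = (\<lambda>b. a * ?r f b)"
    by (rule fps_module.representation_scale) (use assms in \<open>auto simp: basis_seq_def\<close>)
  have "U_pairing q c (fps_scale a f) = (\<Sum>n | ?r f (q n) \<noteq> 0. c n * (a * ?r f (q n)))"
    by (subst U_pairing_superset[OF basis_seq_representation(1)[OF assms]]) (auto simp: r)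
  then show ?thesis by (simp add: U_pairing_def sum_distrib_left mult_ac)
qed

lemma basis_seq_in: "basis_seq q M \<Longrightarrow> q n \<in> M"
  by (auto simp: basis_seq_def intro: fps_module.span_base)

lemma basis_seq_closed:
  assumes "basis_seq q M"
  shows basis_seq_scale_closed: "f \<in> M \<Longrightarrow> fps_scale a f \<in> M"
    and basis_seq_diff_closed: "f \<in> M \<Longrightarrow> g \<in> M \<Longrightarrow> f - g \<in> M"
    and basis_seq_sum_closed: "(\<And>i. i \<in> I \<Longrightarrow> h i \<in> M) \<Longrightarrow> sum h I \<in> M"
  using assms
  by (auto simp: basis_seq_def intro: fps_module.span_scale fps_module.span_diff
      fps_module.span_sum)

lemma basis_seq_0: "basis_seq q M \<Longrightarrow> 0 \<in> M"
  using basis_seq_sum_closed[of q M "{}"] by simp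

lemma U_pairing_diff:
  assumes "basis_seq q M" "f \<in> M" "g \<in> M"
  shows "U_pairing q c (f - g) = U_pairing q c f - U_pairing q c g"
  using U_pairing_add[OF assms(1) basis_seq_diff_closed[OF assms] assms(3), of c] by simp

lemma U_pairing_sum_right:
  assumes "basis_seq q M" "\<And>i. i \<in> I \<Longrightarrow> h i \<in> M"
  shows "U_pairing q c (\<Sum>i\<in>I. h i) = (\<Sum>i\<in>I. U_pairing q c (h i))"
proof -
  have "U_pairing q c 0 = 0"
    using U_pairing_diff[OF assms(1) basis_seq_0 basis_seq_0] assms(1) by force
  then show ?thesis
    using assms(2)
    by (induction I rule: infinite_finite_induct)
      (auto simp: U_pairing_add[OF assms(1)] basis_seq_sum_closed[OF assms(1)])
qed

lemma U_pairing_sum_left: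
  "U_pairing q (\<lambda>k. \<Sum>i\<in>I. a i * w i k) f = (\<Sum>i\<in>I. a i * U_pairing q (w i) f)"
  unfolding U_pairing_def sum_distrib_right sum_distrib_left mult.assoc by (rule sum.swap)

lemma U_pairing_basis:
  assumes "basis_seq q M"
  shows "U_pairing q c (q n) = c n"
proof -
  have "fps_module.representation (range q) (q n) (q m) = (if m = n then 1 else 0)" for m
    using assms
    by (subst fps_module.representation_basis) (auto simp: basis_seq_def inj_eq)
  then show ?thesis by (simp add: U_pairing_def)
qed

text \<open>This identifies U with the dual module of \<open>M\<close>: a linear functional is the
  pairing with the sequence of its values on \<open>q\<close>.\<close>

lemma U_pairing_linear:
  assumes q: "basis_seq q M" "f \<in> M"
    and add: "\<And>f g. f \<in> M \<Longrightarrow> g \<in> M \<Longrightarrow> \<phi> (f + g) = \<phi> f + \<phi> g"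
    and scale: "\<And>a f. f \<in> M \<Longrightarrow> \<phi> (fps_scale a f) = a * \<phi> f"
  shows "U_pairing q (\<lambda>n. \<phi> (q n)) f = \<phi> f"
proof -
  have zero: "\<phi> 0 = 0"
    using add[OF basis_seq_0[OF q(1)] basis_seq_0[OF q(1)]] by simp
  have sum: "\<phi> (\<Sum>i\<in>I. h i) = (\<Sum>i\<in>I. \<phi> (h i))" if "\<And>i. h i \<in> M" for I and h :: "nat \<Rightarrow> 'a fps"
    by (induction I rule: infinite_finite_induct)
      (simp_all add: zero add that basis_seq_sum_closed[OF q(1)])
  show ?thesis
    by (subst (2) basis_seq_representation(2)[OF q, symmetric], subst sum)
      (simp_all add: U_pairing_def scale basis_seq_in[OF q(1)] basis_seq_scale_closed[OF q(1)]
        mult.commute)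
qed

text \<open>The inner sequence holds the coordinates, relative to \<open>q\<close>, of the
  functional with values \<open>c n\<close> on \<open>p n\<close>.\<close>

lemma U_pairing_change_basis:
  assumes "basis_seq q M" "basis_seq p M" "f \<in> M"
  shows "U_pairing q (\<lambda>k. U_pairing p c (q k)) f = U_pairing p c f"
  by (rule U_pairing_linear[OF assms(1,3)])
    (simp_all add: U_pairing_add[OF assms(2)] U_pairing_scale[OF assms(2)])

text \<open>A functional on \<open>M\<close> is determined by its values on the basis
  \<open>p\<close>.\<close>

lemma U_eqI:
  assumes "basis_seq q M" "basis_seq p M" "\<And>n. U_pairing q u (p n) = U_pairing q v (p n)"
  shows "u = v"
proof
  fix k
  \<comment> \<open>The values on \<open>p\<close> recover the functional, and its value at
    \<open>q k\<close> is the coordinate \<open>w k\<close>.\<close>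
  have eq: "w k = U_pairing p (\<lambda>n. U_pairing q w (p n)) (q k)" for w
    by (simp add: U_pairing_change_basis[OF assms(2,1) basis_seq_in[OF assms(1)]]
        U_pairing_basis[OF assms(1)])
  show "u k = v k"
    unfolding eq[of u] eq[of v] assms(3) ..
qed


section \<open>Extending the product formula from a separating family\<close>

definition separating :: "(nat \<Rightarrow> 'a::comm_ring_1 fps) \<Rightarrow> (nat \<Rightarrow> 'a) set \<Rightarrow> bool"
  where "separating q S \<longleftrightarrow> (\<forall>f\<in>fps_gen q. (\<forall>u\<in>S. U_pairing q u f = 0) \<longrightarrow> f = 0)"

text \<open>These are the functionals on U given by evaluation at an element of the span of
  \<open>q\<close>, that is, the finite linear combinations of coordinates.\<close>

definition representable :: "(nat \<Rightarrow> 'a::comm_ring_1 fps) \<Rightarrow> ((nat \<Rightarrow> 'a) \<Rightarrow> 'a) \<Rightarrow> bool"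
  where "representable q \<phi> \<longleftrightarrow> (\<exists>f\<in>fps_gen q. \<forall>u. \<phi> u = U_pairing q u f)"

text \<open>The difference of the two representing elements is annihilated by the separating family,
  hence zero.\<close>

lemma representable_eqI:
  assumes q: "basis_seq q (fps_gen q)" and S: "separating q S"
    and rep: "representable q \<phi>" "representable q \<psi>"
    and eq: "\<And>u. u \<in> S \<Longrightarrow> \<phi> u = \<psi> u"
  shows "\<phi> u = \<psi> u"
proof -
  obtain f g where f: "f \<in> fps_gen q" "\<And>u. \<phi> u = U_pairing q u f"
    and g: "g \<in> fps_gen q" "\<And>u. \<psi> u = U_pairing q u g"
    using rep unfolding representable_def by blast
  have "\<forall>u\<in>S. U_pairing q u (f - g) = 0"
    using eq f g by (simp add: U_pairing_diff[OF q])
  then have "f - g = 0"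
    using S basis_seq_diff_closed[OF q f(1) g(1)] unfolding separating_def by blast
  then show ?thesis using f g by simp
qed

lemma representable_pairing: "f \<in> fps_gen q \<Longrightarrow> representable q (\<lambda>u. U_pairing q u f)"
  unfolding representable_def by blast

lemma representable_scale:
  assumes "basis_seq q (fps_gen q)" "representable q \<phi>"
  shows "representable q (\<lambda>u. a * \<phi> u)"
proof -
  obtain f where "f \<in> fps_gen q" "\<And>u. \<phi> u = U_pairing q u f"
    using assms(2) unfolding representable_def by blast
  then show ?thesis
    unfolding representable_def
    by (intro bexI[of _ "fps_scale a f"])
      (auto simp: U_pairing_scale[OF assms(1)] intro: basis_seq_scale_closed[OF assms(1)])
qed

lemma representable_sum:
  assumes "basis_seq q (fps_gen q)" "\<And>i. i \<in> I \<Longrightarrow> representable q (\<phi> i)"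
  shows "representable q (\<lambda>u. \<Sum>i\<in>I. \<phi> i u)"
proof -
  obtain f where "\<And>i. i \<in> I \<Longrightarrow> f i \<in> fps_gen q" "\<And>i u. i \<in> I \<Longrightarrow> \<phi> i u = U_pairing q u (f i)"
    using assms(2) unfolding representable_def by metis
  then show ?thesis
    unfolding representable_def
    by (intro bexI[of _ "\<Sum>i\<in>I. f i"])
      (auto simp: U_pairing_sum_right[OF assms(1)] intro: basis_seq_sum_closed[OF assms(1)])
qed

lemma representable_nth:
  assumes "basis_seq q (fps_gen q)"
  shows "representable q (\<lambda>u. u n)"
  using representable_pairing[OF basis_seq_in[OF assms], of n] by (simp add: U_pairing_basis[OF assms])

text \<open>Coordinate \<open>k\<close> of a product involves only coordinates up to
  \<open>k\<close> of the factors, and the representation of \<open>f\<close> has finite support. So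
  the pairing is a finite linear combination of coordinates of either factor.\<close>

lemma representable_U_mult:
  assumes "basis_seq q (fps_gen q)"
  shows "representable q (\<lambda>u. U_pairing q (U_mult l u v) f)"
    and "representable q (\<lambda>v. U_pairing q (U_mult l u v) f)"
proof -
  let ?r = "\<lambda>k. fps_module.representation (range q) f (q k)"
  \<comment> \<open>The varying coordinate becomes the last factor, so that
    \<open>representable_scale\<close> applies.\<close>
  have "(\<lambda>u. U_pairing q (U_mult l u v) f) = (\<lambda>u. \<Sum>k | ?r k \<noteq> 0. ?r k *
      (\<Sum>m\<le>k. \<Sum>n\<le>k. (v n * U_unit_mult l m n k) * u m))"
    unfolding U_pairing_def U_mult_def by (simp add: mult_ac)
  then show "representable q (\<lambda>u. U_pairing q (U_mult l u v) f)"
    using assms by (simp add: representable_sum representable_scale representable_nth)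
  have "(\<lambda>v. U_pairing q (U_mult l u v) f) = (\<lambda>v. \<Sum>k | ?r k \<noteq> 0. ?r k *
      (\<Sum>m\<le>k. \<Sum>n\<le>k. (u m * U_unit_mult l m n k) * v n))"
    unfolding U_pairing_def U_mult_def by (simp add: mult_ac)
  then show "representable q (\<lambda>v. U_pairing q (U_mult l u v) f)"
    using assms by (simp add: representable_sum representable_scale representable_nth)
qed

text \<open>Via \<open>sum_U_unit_mult\<close> the case \<open>S = UNIV\<close> is statement (3).
  The coefficient functionals as \<open>S\<close> give (1), and a dual basis as \<open>S\<close>
  gives the multiplication rule in (2).\<close>

definition product_formula_on ::
    "'a::comm_ring_1 \<Rightarrow> (nat \<Rightarrow> 'a fps) \<Rightarrow> (nat \<Rightarrow> 'a fps) \<Rightarrow> (nat \<Rightarrow> 'a) set \<Rightarrow> bool"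
  where "product_formula_on l q p S \<longleftrightarrow>
    (\<forall>u\<in>S. \<forall>v\<in>S. \<forall>N. U_pairing q (U_mult l u v) (p N) =
      (\<Sum>m\<le>N. \<Sum>n\<le>N. U_unit_mult l m n N * (U_pairing q u (p m) * U_pairing q v (p n))))"

lemma product_formula_on_extend:
  assumes q: "basis_seq q (fps_gen q)" and p: "basis_seq p (fps_gen q)"
    and S: "separating q S" and formula: "product_formula_on l q p S"
  shows "product_formula_on l q p T"
proof -
  let ?L = "\<lambda>N u v. U_pairing q (U_mult l u v) (p N)"
  let ?R = "\<lambda>N u v. \<Sum>m\<le>N. \<Sum>n\<le>N. U_unit_mult l m n N * (U_pairing q u (p m) * U_pairing q v (p n))"
  note rep = representable_sum[OF q] representable_scale[OF q]
    representable_pairing[OF basis_seq_in[OF p]]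
  have R1: "representable q (\<lambda>u. ?R N u v)" for N v
  proof -
    have "(\<lambda>u. ?R N u v) = (\<lambda>u. \<Sum>m\<le>N. \<Sum>n\<le>N.
        (U_unit_mult l m n N * U_pairing q v (p n)) * U_pairing q u (p m))"
      by (simp add: mult_ac)
    then show ?thesis by (simp add: rep)
  qed
  have R2: "representable q (\<lambda>v. ?R N u v)" for N u
    by (simp add: rep)
  \<comment> \<open>First \<open>u\<close> is freed while \<open>v\<close> stays in
    \<open>S\<close>.\<close>
  have left: "?L N u v = ?R N u v" if "v \<in> S" for N u v
    by (rule representable_eqI[OF q S representable_U_mult(1)[OF q] R1])
      (use formula that in \<open>simp add: product_formula_on_def\<close>)
  \<comment> \<open>Now \<open>u\<close> is arbitrary and fixed, and \<open>v\<close> is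
    freed.\<close>
  have "?L N u v = ?R N u v" for N u v
    by (rule representable_eqI[OF q S representable_U_mult(2)[OF q] R2]) (rule left)
  then show ?thesis unfolding product_formula_on_def by blast
qed


section \<open>Coefficient functionals and dual bases\<close>

text \<open>The sequence \<open>\<lambda>k. q k $ i\<close> is the coefficient functional at
  \<open>x^i\<close>, written in coordinates relative to \<open>q\<close>.\<close>

lemma U_pairing_nth:
  assumes "basis_seq q M" "f \<in> M"
  shows "U_pairing q (\<lambda>k. q k $ i) f = f $ i"
  by (rule U_pairing_linear[OF assms]) (simp_all add: fps_scale_def)

lemma binomial_type_iff_product_formula:
  assumes q: "basis_seq q (fps_gen q)" "binomial_type l q" and p: "basis_seq p (fps_gen q)"
  shows "binomial_type l p \<longleftrightarrow> product_formula_on l q p (range (\<lambda>i k. q k $ i))"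
proof -
  \<comment> \<open>Here the binomial type of \<open>q\<close> enters: it computes the product of
    two coefficient functionals.\<close>
  have mult: "U_mult l (\<lambda>k. q k $ i) (\<lambda>k. q k $ j) = (\<lambda>k. fps_at_x_plus_y (q k) $ j $ i)" for i j
    using q(2) unfolding binomial_type_nth U_mult_def by (simp add: mult_ac)
  \<comment> \<open>Taking the coefficient of \<open>x^i y^j\<close> in \<open>f(x + y)\<close> is
    linear in \<open>f\<close>, so its values on \<open>q\<close> determine it.\<close>
  have "U_pairing q (\<lambda>k. fps_at_x_plus_y (q k) $ j $ i) (p N) = fps_at_x_plus_y (p N) $ j $ i"
    for i j N
    by (rule U_pairing_linear[OF q(1) basis_seq_in[OF p]])
      (simp_all add: fps_at_x_plus_y_nth fps_scale_def algebra_simps)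
  then show ?thesis
    unfolding product_formula_on_def binomial_type_nth
    by (auto simp: mult U_pairing_nth[OF q(1) basis_seq_in[OF p]])
qed

lemma separating_coefficients:
  assumes "basis_seq q (fps_gen q)"
  shows "separating q (range (\<lambda>i k. q k $ i))"
  unfolding separating_def by (auto simp: U_pairing_nth[OF assms] fps_eq_iff)

text \<open>The functional \<open>v m\<close> reads off the coordinate at \<open>p m\<close>, so a
  common zero has all its coordinates zero.\<close>

lemma separating_dual:
  assumes q: "basis_seq q (fps_gen q)" and p: "basis_seq p (fps_gen q)"
    and dual: "\<And>m n. U_pairing q (v m) (p n) = (if m = n then 1 else 0)"
  shows "separating q (range v)"
  unfolding separating_def
proof (intro ballI impI)
  fix f assume f: "f \<in> fps_gen q" and zero: "\<forall>u\<in>range v. U_pairing q u f = 0"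
  let ?r = "\<lambda>n. fps_module.representation (range p) f (p n)"
  have "?r m = 0" for m
  proof -
    have "U_pairing q (v m) f = U_pairing p (\<lambda>n. if m = n then 1 else 0) f"
      using U_pairing_change_basis[OF p q f, of "v m"] by (simp add: dual)
    also have "\<dots> = ?r m"
      using basis_seq_representation(1)[OF p f]
      by (simp add: U_pairing_def if_distrib[of "\<lambda>x. x * _"] cong: if_cong)
    finally show ?thesis using zero by simp
  qed
  then show "f = 0" using basis_seq_representation(2)[OF p f] by simp
qed

section \<open>Convergence in U and the dual pseudo-basis\<close>

lemma U_sums_iff: "U_sums w s \<longleftrightarrow> (\<forall>j. \<forall>\<^sub>F M in sequentially. s j = (\<Sum>n<M. w n j))"
proof
  assume L: "U_sums w s"
  show "\<forall>j. \<forall>\<^sub>F M in sequentially. s j = (\<Sum>n<M. w n j)"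
  proof
    fix j
    \<comment> \<open>Coordinate \<open>j\<close> is constrained only from the filtration step
      \<open>Suc j\<close> on.\<close>
    have "\<forall>\<^sub>F M in sequentially. (\<lambda>k. s k - (\<Sum>n<M. w n k)) \<in> U_filtration (Suc j)"
      using L unfolding U_sums_def by blast
    then show "\<forall>\<^sub>F M in sequentially. s j = (\<Sum>n<M. w n j)"
      by (rule eventually_mono) (simp add: U_filtration_def)
  qed
next
  assume R: "\<forall>j. \<forall>\<^sub>F M in sequentially. s j = (\<Sum>n<M. w n j)"
  show "U_sums w s"
    unfolding U_sums_def
  proof
    fix N
    have "\<forall>\<^sub>F M in sequentially. \<forall>j\<in>{..<N}. s j = (\<Sum>n<M. w n j)"
      using R by (simp add: eventually_ball_finite_distrib)
    then show "\<forall>\<^sub>F M in sequentially. (\<lambda>k. s k - (\<Sum>n<M. w n k)) \<in> U_filtration N"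
      by (rule eventually_mono) (simp add: U_filtration_def)
  qed
qed

text \<open>As a functional, member \<open>m\<close> sends an element to its coefficient at
  \<open>p m\<close>; the sequence lists the values on \<open>q\<close>.\<close>

definition dual_seq ::
    "(nat \<Rightarrow> 'a::comm_ring_1 fps) \<Rightarrow> (nat \<Rightarrow> 'a fps) \<Rightarrow> nat \<Rightarrow> nat \<Rightarrow> 'a"
  where "dual_seq q p m = (\<lambda>k. fps_module.representation (range p) (q k) (p m))"

text \<open>At coordinate \<open>j\<close> the partial sums are those of the pairing of
  \<open>c\<close> with \<open>q j\<close>, which has finite support relative to \<open>p\<close>.
  They become constant, so every such series converges.\<close>

lemma U_sums_dual_seq:
  assumes q: "basis_seq q M" and p: "basis_seq p M"
  shows "U_sums (\<lambda>n j. c n * dual_seq q p n j) s \<longleftrightarrow> s = (\<lambda>j. U_pairing p c (q j))"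
proof -
  have ev: "\<forall>\<^sub>F M in sequentially. (\<Sum>n<M. c n * dual_seq q p n j) = U_pairing p c (q j)" for j
  proof -
    obtain K where "\<And>n. fps_module.representation (range p) (q j) (p n) \<noteq> 0 \<Longrightarrow> n < K"
      using basis_seq_representation(1)[OF p basis_seq_in[OF q, of j]]
      unfolding finite_nat_set_iff_bounded by blast
    then have "(\<Sum>n<M. c n * dual_seq q p n j) = U_pairing p c (q j)" if "M \<ge> K" for M
      unfolding dual_seq_def using that by (subst U_pairing_superset[of "{..<M}"]) force+
    then show ?thesis unfolding eventually_sequentially by blast
  qed
  have "(\<forall>\<^sub>F M in sequentially. s j = (\<Sum>n<M. c n * dual_seq q p n j)) \<longleftrightarrow>
      s j = U_pairing p c (q j)" for j
  proof
    assume "\<forall>\<^sub>F M in sequentially. s j = (\<Sum>n<M. c n * dual_seq q p n j)"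
    with ev[of j] have "\<forall>\<^sub>F M in sequentially. s j = U_pairing p c (q j)"
      by eventually_elim simp
    then show "s j = U_pairing p c (q j)" by simp
  next
    assume "s j = U_pairing p c (q j)"
    with ev[of j] show "\<forall>\<^sub>F M in sequentially. s j = (\<Sum>n<M. c n * dual_seq q p n j)"
      by (simp add: eq_commute)
  qed
  then show ?thesis unfolding U_sums_iff fun_eq_iff by simp
qed

text \<open>By change of basis in both directions, the map from \<open>c\<close> to the limit is a
  bijection; its inverse lists the values of \<open>s\<close> on \<open>p\<close>.\<close>

lemma U_pseudo_basis_dual_seq:
  assumes q: "basis_seq q M" and p: "basis_seq p M"
  shows "U_pseudo_basis (dual_seq q p)"
proof -
  have "(\<lambda>n. U_pairing q (\<lambda>j. U_pairing p c (q j)) (p n)) = c"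
      "(\<lambda>j. U_pairing p (\<lambda>n. U_pairing q s (p n)) (q j)) = s" for s c
    by (simp_all add: U_pairing_change_basis[OF q p basis_seq_in[OF p]]
        U_pairing_change_basis[OF p q basis_seq_in[OF q]] U_pairing_basis[OF q] U_pairing_basis[OF p])
  then have iff: "s = (\<lambda>j. U_pairing p c (q j)) \<longleftrightarrow> c = (\<lambda>n. U_pairing q s (p n))" for s c
    by metis
  show ?thesis
    unfolding U_pseudo_basis_def U_sums_dual_seq[OF assms]
  proof (intro conjI allI)
    show "\<exists>!c. s = (\<lambda>j. U_pairing p c (q j))" for s
      unfolding iff by simp
  qed blast
qed

lemma U_pairing_dual_seq:
  assumes q: "basis_seq q M" and p: "basis_seq p M"
  shows "U_pairing q (dual_seq q p m) (p n) = (if m = n then 1 else 0)"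
proof -
  \<comment> \<open>\<open>dual_seq q p m\<close> is the functional whose values on \<open>p\<close>
    form the unit sequence at \<open>m\<close>.\<close>
  have "dual_seq q p m k = U_pairing p (\<lambda>n. if n = m then 1 else 0) (q k)" for k
    using basis_seq_representation(1)[OF p basis_seq_in[OF q, of k]]
    by (simp add: dual_seq_def U_pairing_def if_distrib[of "\<lambda>x. x * _"] cong: if_cong)
  then have "dual_seq q p m = (\<lambda>k. U_pairing p (\<lambda>n. if n = m then 1 else 0) (q k))" ..
  then show ?thesis
    using U_pairing_change_basis[OF q p basis_seq_in[OF p]]
    by (simp add: U_pairing_basis[OF p])
qed

text \<open>An equation in U can be tested by pairing with all \<open>p N\<close>. The divided power
  expression and the right side of the product formula both yield the structure constant
  \<open>U_unit_mult l m n N\<close>.\<close>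

lemma product_formula_iff_divided_powers:
  assumes q: "basis_seq q (fps_gen q)" and p: "basis_seq p (fps_gen q)"
    and dual: "\<And>m n. U_pairing q (v m) (p n) = (if m = n then 1 else 0)"
  shows "product_formula_on l q p (range v) \<longleftrightarrow>
    (\<forall>m n. U_mult l (v m) (v n) =
      (\<lambda>j. \<Sum>k\<le>m. of_nat ((m + n - k) choose n) * of_nat (n choose k) * l ^ k * v (m + n - k) j))"
    (is "_ \<longleftrightarrow> (\<forall>m n. _ = ?w m n)")
proof -
  have w: "U_pairing q (?w m n) (p N) = U_unit_mult l m n N" for m n N
    unfolding U_pairing_sum_left U_unit_mult_def U_unit_def by (simp add: dual eq_commute)
  have "U_mult l (v m) (v n) = ?w m n \<longleftrightarrow>
      (\<forall>N. U_pairing q (U_mult l (v m) (v n)) (p N) = U_unit_mult l m n N)" for m n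
  proof
    assume "\<forall>N. U_pairing q (U_mult l (v m) (v n)) (p N) = U_unit_mult l m n N"
    then show "U_mult l (v m) (v n) = ?w m n"
      by (intro U_eqI[OF q p]) (simp only: w)
  qed (simp only: w simp_thms)
  then show ?thesis
    unfolding product_formula_on_def by (simp only: dual sum_U_unit_mult_delta ball_simps)
qed

theorem theorem3p10:
  fixes l :: "'a::comm_ring_1" and q p :: "nat \<Rightarrow> 'a fps"
  assumes "fps_pseudo_basis q" and "binomial_type l q"
    and "basis_seq p (fps_gen q)"
  shows
    "(binomial_type l p \<longleftrightarrow>
       (\<exists>v. divided_power_pseudo_basis l v \<and>
         (\<forall>m n. U_pairing q (v m) (p n) = (if m = n then 1 else 0)))) \<and>
     (binomial_type l p \<longleftrightarrow>
       (\<forall>u v n. U_pairing q (U_mult l u v) (p n) =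
         (\<Sum>i\<le>n. \<Sum>j\<le>n. l ^ i * of_nat (n choose j) * of_nat (j choose i) *
           U_pairing q u (p (n + i - j)) * U_pairing q v (p j))))"
proof -
  note p = assms(3)
  have q: "basis_seq q (fps_gen q)"
    by (rule fps_pseudo_basis_imp_basis_seq) fact
  note extend = product_formula_on_extend[OF q p]
  have 1: "binomial_type l p \<longleftrightarrow> product_formula_on l q p UNIV"
    unfolding binomial_type_iff_product_formula[OF q assms(2) p]
  proof
    assume "product_formula_on l q p (range (\<lambda>i k. q k $ i))"
    then show "product_formula_on l q p UNIV"
      by (rule extend[OF separating_coefficients[OF q]])
  qed (simp add: product_formula_on_def)
  have 2: "product_formula_on l q p UNIV \<longleftrightarrow>
      (\<exists>v. divided_power_pseudo_basis l v \<and>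
        (\<forall>m n. U_pairing q (v m) (p n) = (if m = n then 1 else 0)))"
  proof
    assume "product_formula_on l q p UNIV"
    \<comment> \<open>The witness is the dual sequence. It is already a pseudo-basis, so only its
      multiplication rule has to come from the product formula.\<close>
    then have "product_formula_on l q p (range (dual_seq q p))"
      by (simp add: product_formula_on_def)
    then have "divided_power_pseudo_basis l (dual_seq q p)"
      using U_pseudo_basis_dual_seq[OF q p]
      unfolding product_formula_iff_divided_powers[OF q p U_pairing_dual_seq[OF q p]]
        divided_power_pseudo_basis_def by (intro conjI)
    then show "\<exists>v. divided_power_pseudo_basis l v \<and>
        (\<forall>m n. U_pairing q (v m) (p n) = (if m = n then 1 else 0))"
      using U_pairing_dual_seq[OF q p] by blast
  next
    assume "\<exists>v. divided_power_pseudo_basis l v \<and>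
        (\<forall>m n. U_pairing q (v m) (p n) = (if m = n then 1 else 0))"
    then obtain v where v: "divided_power_pseudo_basis l v"
      and dual: "\<And>m n. U_pairing q (v m) (p n) = (if m = n then 1 else 0)" by blast
    \<comment> \<open>The multiplication rule is the formula on the members of \<open>v\<close>,
      which separate points by duality.\<close>
    have "product_formula_on l q p (range v)"
      using v unfolding product_formula_iff_divided_powers[OF q p dual]
        divided_power_pseudo_basis_def by (rule conjunct2)
    then show "product_formula_on l q p UNIV"
      by (rule extend[OF separating_dual[OF q p dual]])
  qed
  have 3: "product_formula_on l q p UNIV \<longleftrightarrow>
      (\<forall>u v n. U_pairing q (U_mult l u v) (p n) =
        (\<Sum>i\<le>n. \<Sum>j\<le>n. l ^ i * of_nat (n choose j) * of_nat (j choose i) *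
          U_pairing q u (p (n + i - j)) * U_pairing q v (p j)))"
    \<comment> \<open>The structure constants are turned back into the explicit double sum of
      (3).\<close>
    unfolding product_formula_on_def ball_UNIV
      sum_U_unit_mult[where G = "\<lambda>m n. U_pairing q _ (p m) * U_pairing q _ (p n)", symmetric]
    by (simp only: mult.assoc)
  from 1 2 3 show ?thesis by blast
qed

end
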